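(* Let $T=\{1,\dots,m\}$, let $a_t\in\mathbb{R}^n$ ($t\in T$) and $c_1,\dots,c_q\in\mathbb{R}^n$ be fixed, and let $\mathcal{P}:\mathbb{R}^T\rightrightarrows\mathbb{R}^q$ be the Pareto front mapping and $\mathcal{E}_{\mathcal{P}}$ the epigraphical Pareto front mapping of the parameterized linear multiobjective problem (see context). Let $(\overline{b},\overline{p})\in\mathrm{gph}\,\mathcal{P}$. Then $$\partial\mathcal{P}(\overline{b},\overline{p})=\bigcup_{\alpha\in\mathbb{R}^q_+,\ \|\alpha\|_*=1}\Big\{y\in\mathbb{R}^T\ \Big|\ \langle y,b-\overline{b}\rangle\le\langle\alpha,p-\overline{p}\rangle\ \text{ for all }(b,p)\in\mathrm{gph}\,\mathcal{P}\Big\}.$$ Furthermore, $$\mathrm{lip}\,\mathcal{E}_{\mathcal{P}}(\overline{b},\overline{p})=\sup\{\|y\|_1: y\in\partial\mathcal{P}(\overline{b},\overline{p})\},$$ and $\mathcal{E}_{\mathcal{P}}$ is Lipschitz-like around $(\overline{b},\overline{p})$ if and only if $$\sup\Big\{\|y\|_1\ \Big|\ y\in\bigcup_{\alpha\in\mathbb{R}^q_+,\ \|\alpha\|_*=1}\big\{y\in\mathbb{R}^T: \langle y,b-\overline{b}\rangle\le\langle\alpha,p-\overline{p}\rangle\ \text{ for all }(b,p)\in\mathrm{gph}\,\mathcal{P}\big\}\Big\}<\infty.$$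
   Context: $\mathbb{R}^n$ and $\mathbb{R}^q$ carry arbitrary norms, $\|\cdot\|_*$ denotes the corresponding dual norm; $\mathbb{R}^T$ carries the supremum norm, whose dual norm is the $\ell_1$-norm $\|\cdot\|_1$. For $b=(b_t)_{t\in T}\in\mathbb{R}^T$: $\mathcal{F}(b):=\{x\in\mathbb{R}^n:\langle a_t,x\rangle\le b_t,\ t\in T\}$. $\mathcal{S}(b)$ is the set of all $x\in\mathcal{F}(b)$ for which there is no $y\in\mathcal{F}(b)$ with $\langle c_i,y\rangle\le\langle c_i,x\rangle$ for all $i=1,\dots,q$ and $\langle c_{i_0},y\rangle<\langle c_{i_0},x\rangle$ for some $i_0$. The Pareto front mapping is $\mathcal{P}(b):=\{(\langle c_1,x\rangle,\dots,\langle c_q,x\rangle): x\in\mathcal{S}(b)\}\subset\mathbb{R}^q$, and $\mathcal{E}_{\mathcal{P}}(b):=\mathcal{P}(b)+\mathbb{R}^q_+$, where $\mathbb{R}^q_+$ is the set of vectors with nonnegative components. The graph of a set-valued mapping $\mathcal{M}$ is $\mathrm{gph}\,\mathcal{M}=\{(y,z): z\in\mathcal{M}(y)\}$. For a convex set $\Omega$ and $\overline{w}\in\Omega$, $N(\overline{w};\Omega)=\{w^*:\langle w^*,w-\overline{w}\rangle\le0\ \forall w\in\Omega\}$. For $\mathcal{M}$ with convex graph, $y^*\in D^*\mathcal{M}(\overline{y},\overline{z})(z^* )\iff(y^*,-z^* )\in N((\overline{y},\overline{z});\mathrm{gph}\,\mathcal{M})$. The graph of $\mathcal{E}_{\mathcal{P}}$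 is convex, and the subdifferential of $\mathcal{P}$ (with ordering cone $\mathbb{R}^q_+$) is $$\partial\mathcal{P}(\overline{b},\overline{p}):=\{y: y\in D^*\mathcal{E}_{\mathcal{P}}(\overline{b},\overline{p})(z^* )\ \text{for some } z^*\in\mathbb{R}^q\text{ with }-z^*\in N(0_q;\mathbb{R}^q_+),\ \|z^*\|_*=1\}.$$ A set-valued mapping $\mathcal{M}$ between metric spaces is Lipschitz-like around $(\overline{y},\overline{z})\in\mathrm{gph}\,\mathcal{M}$ if there are neighborhoods $U$ of $\overline{y}$, $V$ of $\overline{z}$ and $\ell\ge0$ with $d(z,\mathcal{M}(y'))\le\ell\,d(y,y')$ for all $y,y'\in U$ and $z\in V\cap\mathcal{M}(y)$ (where $d(z,\emptyset)=\infty$). The Lipschitz modulus $\mathrm{lip}\,\mathcal{M}(\overline{y},\overline{z})\in[0,\infty]$ is the infimum of all such constants $\ell$ (over all neighborhoods), equal to $\infty$ if there are none. *)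

theory Defs
  imports "HOL-Analysis.Analysis"
begin

section \<open>Norms and duality\<close>

text \<open>The type class norm on \<open>real ^ 'n\<close> is the Euclidean one. An arbitrary norm is
  therefore an explicit function. The supremum norm is the library's \<open>infnorm\<close>.\<close>

definition is_norm :: "('a::real_vector \<Rightarrow> real) \<Rightarrow> bool" where
  "is_norm N \<longleftrightarrow>
     (\<forall>x. N x = 0 \<longleftrightarrow> x = 0) \<and>
     (\<forall>r x. N (r *\<^sub>R x) = \<bar>r\<bar> * N x) \<and>
     (\<forall>x y. N (x + y) \<le> N x + N y)"

definition dual_norm :: "('a::real_inner \<Rightarrow> real) \<Rightarrow> 'a \<Rightarrow> real" where
  "dual_norm N u = (SUP x \<in> {x. N x \<le> 1}. u \<bullet> x)"

definition l1_norm :: "real ^ 'm \<Rightarrow> real" where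
  "l1_norm y = (\<Sum>t\<in>UNIV. \<bar>y $ t\<bar>)"

section \<open>Set-valued mappings\<close>

definition gph :: "('a \<Rightarrow> 'b set) \<Rightarrow> ('a \<times> 'b) set" where
  "gph M = {(y, z). z \<in> M y}"

definition normal_cone :: "'a::real_inner set \<Rightarrow> 'a \<Rightarrow> 'a set" where
  "normal_cone \<Omega> w0 = {w'. \<forall>w\<in>\<Omega>. w' \<bullet> (w - w0) \<le> 0}"

definition coderivative ::
    "('a::real_inner \<Rightarrow> 'b::real_inner set) \<Rightarrow> 'a \<Rightarrow> 'b \<Rightarrow> 'b \<Rightarrow> 'a set" where
  "coderivative M y0 z0 z' = {y'. (y', - z') \<in> normal_cone (gph M) (y0, z0)}"

text \<open>The metrics are explicit arguments \<open>d\<close>, because they come from norms other than the type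
  class norm. In \<open>ereal\<close> the infimum of the empty set is \<open>\<infinity>\<close>, so the distance to the empty set
  and the Lipschitz modulus of a mapping without Lipschitz constants are \<open>\<infinity>\<close>.\<close>

definition dist_to_set :: "('b \<Rightarrow> 'b \<Rightarrow> real) \<Rightarrow> 'b \<Rightarrow> 'b set \<Rightarrow> ereal" where
  "dist_to_set d z A = (INF w\<in>A. ereal (d z w))"

definition nbhd :: "('a \<Rightarrow> 'a \<Rightarrow> real) \<Rightarrow> 'a \<Rightarrow> 'a set \<Rightarrow> bool" where
  "nbhd d y U \<longleftrightarrow> (\<exists>r>0. {y'. d y y' < r} \<subseteq> U)"

definition lip_constant ::
    "('a \<Rightarrow> 'a \<Rightarrow> real) \<Rightarrow> ('b \<Rightarrow> 'b \<Rightarrow> real) \<Rightarrow> ('a \<Rightarrow> 'b set) \<Rightarrow> 'a \<Rightarrow> 'b \<Rightarrow> real \<Rightarrow> bool" where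
  "lip_constant dY dZ M y0 z0 l \<longleftrightarrow>
     0 \<le> l \<and>
     (\<exists>U V. nbhd dY y0 U \<and> nbhd dZ z0 V \<and>
        (\<forall>y\<in>U. \<forall>y'\<in>U. \<forall>z\<in>V \<inter> M y. dist_to_set dZ z (M y') \<le> ereal (l * dY y y')))"

definition lipschitz_like ::
    "('a \<Rightarrow> 'a \<Rightarrow> real) \<Rightarrow> ('b \<Rightarrow> 'b \<Rightarrow> real) \<Rightarrow> ('a \<Rightarrow> 'b set) \<Rightarrow> 'a \<Rightarrow> 'b \<Rightarrow> bool" where
  "lipschitz_like dY dZ M y0 z0 \<longleftrightarrow>
     (y0, z0) \<in> gph M \<and> (\<exists>l. lip_constant dY dZ M y0 z0 l)"

definition lip_modulus ::
    "('a \<Rightarrow> 'a \<Rightarrow> real) \<Rightarrow> ('b \<Rightarrow> 'b \<Rightarrow> real) \<Rightarrow> ('a \<Rightarrow> 'b set) \<Rightarrow> 'a \<Rightarrow> 'b \<Rightarrow> ereal" where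
  "lip_modulus dY dZ M y0 z0 = (INF l \<in> {l. lip_constant dY dZ M y0 z0 l}. ereal l)"

section \<open>Ordering cone, epigraphical mapping and subdifferential\<close>

definition nonneg_orthant :: "(real ^ 'q) set" where
  "nonneg_orthant = {p. \<forall>i. 0 \<le> p $ i}"

definition epi_map :: "('a \<Rightarrow> (real ^ 'q) set) \<Rightarrow> 'a \<Rightarrow> (real ^ 'q) set" where
  "epi_map M y = {p + r | p r. p \<in> M y \<and> r \<in> nonneg_orthant}"

definition subdifferential ::
    "(real ^ 'q \<Rightarrow> real) \<Rightarrow> ('a::real_inner \<Rightarrow> (real ^ 'q) set) \<Rightarrow> 'a \<Rightarrow> real ^ 'q \<Rightarrow> 'a set" where
  "subdifferential N M y0 p0 =
     {y. \<exists>z'. - z' \<in> normal_cone nonneg_orthant 0 \<and> dual_norm N z' = 1 \<and>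
              y \<in> coderivative (epi_map M) y0 p0 z'}"

section \<open>The parameterized linear multiobjective problem\<close>

definition feasible_set :: "('m \<Rightarrow> real ^ 'n) \<Rightarrow> real ^ 'm \<Rightarrow> (real ^ 'n) set" where
  "feasible_set a b = {x. \<forall>t. a t \<bullet> x \<le> b $ t}"

definition efficient_set ::
    "('m \<Rightarrow> real ^ 'n) \<Rightarrow> ('q \<Rightarrow> real ^ 'n) \<Rightarrow> real ^ 'm \<Rightarrow> (real ^ 'n) set" where
  "efficient_set a c b =
     {x \<in> feasible_set a b.
        \<not> (\<exists>y \<in> feasible_set a b. (\<forall>i. c i \<bullet> y \<le> c i \<bullet> x) \<and> (\<exists>i0. c i0 \<bullet> y < c i0 \<bullet> x))}"

definition pareto_front ::
    "('m \<Rightarrow> real ^ 'n) \<Rightarrow> ('q \<Rightarrow> real ^ 'n) \<Rightarrow> real ^ 'm \<Rightarrow> (real ^ 'q) set" where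
  "pareto_front a c b = (\<lambda>x. \<chi> i. c i \<bullet> x) ` efficient_set a c b"

end

theory Submission
  imports Defs
begin

text \<open>
  The formula for the subdifferential holds because a normal to the epigraph with a nonnegative
  component \<open>\<alpha>\<close> is already determined by the graph: adding \<open>r \<ge> 0\<close> to a point \<open>p\<close> only increases
  \<open>\<alpha> \<bullet> (p - p0)\<close> (\<open>coderivative_epi_map_iff\<close>).

  The formula for the modulus rests on polyhedrality. Let \<open>G\<close> be the set of all pairs \<open>(b, p)\<close> for
  which some feasible point has objective values at most \<open>p\<close>. It is a finitely generated cone,
  hence a polyhedron, and so coincides with its tangent cone near each of its points. At a
  Pareto point \<open>(b0, p0)\<close> no coordinate of \<open>p0\<close> can be decreased inside \<open>G\<close>; each such decrease is
  therefore blocked by one of the active inequalities, and the sum of these is a normal to \<open>G\<close>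
  whose \<open>p\<close>-component is strictly positive (\<open>strictly_positive_normal_at_pareto_point\<close>). This
  normal bounds a positive combination of the objectives from below on every feasible set, which
  has two consequences. Every feasible point is dominated by an efficient one, so \<open>G\<close> is the graph
  of the epigraphical mapping (\<open>gph_epi_map_pareto_front\<close>); and the subdifferential is nonempty.

  For a mapping with polyhedral graph, \<open>l \<ge> 0\<close> is a Lipschitz constant at a point if and only
  if every \<open>y\<close> in the coderivative at \<open>\<alpha>\<close> satisfies \<open>l1_norm y \<le> l * dual_norm N \<alpha>\<close>
  (\<open>coderivative_bound_of_lip_constant\<close>, \<open>lip_constant_of_coderivative_bound\<close>). For the nontrivial
  direction, a violation of the Lipschitz estimate would allow to separate a norm ball from the
  tangent cone, and the separating functional would be a normal violating the bound.

  Normals with \<open>\<alpha> \<noteq> 0\<close> are positive multiples of those that define the subdifferential. A normal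
  \<open>(y, 0)\<close> is a direction of recession of the nonempty subdifferential, so that \<open>y = 0\<close> as soon as
  the subdifferential is bounded (\<open>coderivative_bound_of_subdifferential_bound\<close>). Hence the
  Lipschitz constants are exactly the real upper bounds of the supremum in the theorem.
\<close>

section \<open>Norms given as functions\<close>

lemma is_norm_nonneg:
  assumes "is_norm N" shows "0 \<le> N x"
proof -
  have "N 0 \<le> N x + N (- x)"
    using assms unfolding is_norm_def by (metis add.right_inverse)
  moreover have "N (- x) = N x"
    using assms unfolding is_norm_def
    by (metis abs_minus_cancel abs_one mult_1 scaleR_minus1_left)
  ultimately show ?thesis
    using assms unfolding is_norm_def by (metis add_nonneg_nonneg linorder_not_le add_neg_neg)
qed

lemma is_norm_minus_commute:
  assumes "is_norm N" shows "N (x - y) = N (y - x)"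
proof -
  have "N (- (y - x)) = N (y - x)"
    using assms unfolding is_norm_def
    by (metis abs_minus_cancel abs_one mult_1 scaleR_minus1_left)
  then show ?thesis by simp
qed

lemma is_norm_scaleR: "is_norm N \<Longrightarrow> N (r *\<^sub>R x) = \<bar>r\<bar> * N x"
  and is_norm_triangle: "is_norm N \<Longrightarrow> N (x + y) \<le> N x + N y"
  and is_norm_eq_0_iff: "is_norm N \<Longrightarrow> N x = 0 \<longleftrightarrow> x = 0"
  unfolding is_norm_def by blast+

lemma is_norm_convex_on:
  assumes "is_norm N" shows "convex_on UNIV N"
proof (rule convex_onI)
  fix t :: real and x y assume "0 < t" "t < 1"
  then show "N ((1 - t) *\<^sub>R x + t *\<^sub>R y) \<le> (1 - t) * N x + t * N y"
    using is_norm_triangle[OF assms, of "(1 - t) *\<^sub>R x" "t *\<^sub>R y"]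
    by (simp add: is_norm_scaleR[OF assms])
qed simp

lemma is_norm_continuous_on:
  fixes N :: "'a::euclidean_space \<Rightarrow> real"
  assumes "is_norm N" shows "continuous_on UNIV N"
  using convex_on_continuous[OF open_UNIV is_norm_convex_on[OF assms]] .

text \<open>The minimum of \<open>N\<close> on the compact Euclidean unit sphere is positive, and homogeneity
  extends the resulting estimate to all vectors.\<close>

lemma norm_le_is_norm:
  fixes N :: "'a::euclidean_space \<Rightarrow> real"
  assumes "is_norm N"
  obtains k where "0 < k" "\<And>x. norm x \<le> k * N x"
proof -
  have "sphere (0::'a) 1 \<noteq> {}" by simp
  then obtain u where u: "u \<in> sphere 0 1" "\<And>v. v \<in> sphere 0 1 \<Longrightarrow> N u \<le> N v"
    using continuous_attains_inf[OF compact_sphere, of "0::'a" 1 N]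
      continuous_on_subset[OF is_norm_continuous_on[OF assms]] by blast
  have "N u > 0"
    using u(1) is_norm_nonneg[OF assms, of u] is_norm_eq_0_iff[OF assms, of u] by force
  moreover have "norm x \<le> (1 / N u) * N x" for x
  proof (cases "x = 0")
    case False
    have "N u \<le> N ((1 / norm x) *\<^sub>R x)"
      using False by (intro u(2)) simp
    also have "\<dots> = N x / norm x" by (simp add: is_norm_scaleR[OF assms])
    finally show ?thesis using False \<open>N u > 0\<close> by (simp add: field_simps)
  qed (use is_norm_nonneg[OF assms, of 0] \<open>N u > 0\<close> in simp)
  ultimately show ?thesis using that[of "1 / N u"] by simp
qed

lemma compact_is_norm_ball:
  fixes N :: "'a::euclidean_space \<Rightarrow> real"
  assumes "is_norm N" shows "compact {z. N (z - p) \<le> d}"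
proof -
  obtain k where k: "0 < k" "\<And>x. norm x \<le> k * N x" using norm_le_is_norm[OF assms] by blast
  have "{z. N (z - p) \<le> d} \<subseteq> cball p (k * d)"
  proof
    fix z assume "z \<in> {z. N (z - p) \<le> d}"
    then have "k * N (z - p) \<le> k * d" using k(1) by simp
    then show "z \<in> cball p (k * d)"
      using k(2)[of "z - p"] by (simp add: dist_norm norm_minus_commute)
  qed
  moreover have "closed {z. N (z - p) \<le> d}"
    by (intro closed_Collect_le continuous_intros
        continuous_on_compose2[OF is_norm_continuous_on[OF assms]]) auto
  ultimately show ?thesis
    using bounded_cball bounded_subset compact_eq_bounded_closed by blast
qed

lemma convex_is_norm_ball:
  assumes "is_norm N" shows "convex {z. N (z - p) \<le> d}"
proof (rule convexI)
  fix x y and u v :: real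
  assume *: "x \<in> {z. N (z - p) \<le> d}" "y \<in> {z. N (z - p) \<le> d}" "0 \<le> u" "0 \<le> v" "u + v = 1"
  have "u *\<^sub>R x + v *\<^sub>R y - p = u *\<^sub>R (x - p) + v *\<^sub>R (y - p)"
    using scaleR_left_distrib[of u v p] *(5) by (simp add: algebra_simps)
  then have "N (u *\<^sub>R x + v *\<^sub>R y - p) \<le> u * N (x - p) + v * N (y - p)"
    using is_norm_triangle[OF assms, of "u *\<^sub>R (x - p)" "v *\<^sub>R (y - p)"] *
    by (simp add: is_norm_scaleR[OF assms])
  also have "\<dots> \<le> u * d + v * d" using * by (intro add_mono mult_left_mono) auto
  also have "\<dots> = d" using *(5) by (metis distrib_right mult_1)
  finally show "u *\<^sub>R x + v *\<^sub>R y \<in> {z. N (z - p) \<le> d}" by simp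
qed

text \<open>Since \<open>dual_norm\<close> is a real supremum, it dominates its members only once the set is known to
  be bounded above; the comparison with the Euclidean norm provides this.\<close>

lemma inner_le_dual_norm_unit:
  fixes N :: "'a::euclidean_space \<Rightarrow> real"
  assumes "is_norm N" "N x \<le> 1" shows "\<alpha> \<bullet> x \<le> dual_norm N \<alpha>"
  unfolding dual_norm_def
proof (rule cSUP_upper)
  obtain k where k: "0 < k" "\<And>x. norm x \<le> k * N x" using norm_le_is_norm[OF assms(1)] by blast
  show "bdd_above ((\<bullet>) \<alpha> ` {x. N x \<le> 1})"
  proof (rule bdd_aboveI2)
    fix x assume "x \<in> {x. N x \<le> 1}"
    then have "k * N x \<le> k" using k(1) by (simp add: mult_left_le)
    then have "norm x \<le> k" using k(2)[of x] by (rule order_trans[rotated])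
    then show "\<alpha> \<bullet> x \<le> norm \<alpha> * k"
      by (meson norm_cauchy_schwarz mult_left_mono norm_ge_zero order_trans)
  qed
qed (use assms in simp)

lemma inner_le_dual_norm:
  fixes N :: "'a::euclidean_space \<Rightarrow> real"
  assumes "is_norm N" shows "\<alpha> \<bullet> x \<le> dual_norm N \<alpha> * N x"
proof (cases "x = 0")
  case False
  then have "N x > 0"
    using is_norm_nonneg[OF assms, of x] is_norm_eq_0_iff[OF assms, of x] by simp
  then have "\<alpha> \<bullet> ((1 / N x) *\<^sub>R x) \<le> dual_norm N \<alpha>"
    by (intro inner_le_dual_norm_unit[OF assms]) (simp add: is_norm_scaleR[OF assms])
  then show ?thesis using \<open>N x > 0\<close> by (simp add: field_simps)
qed (use is_norm_eq_0_iff[OF assms, of x] in simp)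

lemma dual_norm_le:
  assumes "is_norm N" "\<And>x. N x \<le> 1 \<Longrightarrow> \<alpha> \<bullet> x \<le> B" shows "dual_norm N \<alpha> \<le> B"
  unfolding dual_norm_def
proof (rule cSUP_least)
  have "0 \<in> {x. N x \<le> 1}" using is_norm_eq_0_iff[OF assms(1), of 0] by simp
  then show "{x. N x \<le> 1} \<noteq> {}" by blast
qed (use assms in simp)

lemma dual_norm_pos:
  fixes N :: "'a::euclidean_space \<Rightarrow> real"
  assumes "is_norm N" "\<alpha> \<noteq> 0" shows "0 < dual_norm N \<alpha>"
proof -
  have "0 < \<alpha> \<bullet> \<alpha>" using assms(2) by simp
  also have "\<dots> \<le> dual_norm N \<alpha> * N \<alpha>" by (rule inner_le_dual_norm[OF assms(1)])
  finally show ?thesis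
    using is_norm_nonneg[OF assms(1), of \<alpha>] by (simp add: zero_less_mult_iff)
qed

lemma dual_norm_scaleR:
  fixes N :: "'a::euclidean_space \<Rightarrow> real"
  assumes "is_norm N" "0 < r" shows "dual_norm N (r *\<^sub>R \<alpha>) = r * dual_norm N \<alpha>"
proof (rule antisym)
  show "dual_norm N (r *\<^sub>R \<alpha>) \<le> r * dual_norm N \<alpha>"
    using assms inner_le_dual_norm_unit[OF assms(1)] by (intro dual_norm_le) auto
  have "dual_norm N \<alpha> \<le> dual_norm N (r *\<^sub>R \<alpha>) / r"
  proof (rule dual_norm_le[OF assms(1)])
    fix x assume "N x \<le> 1"
    then show "\<alpha> \<bullet> x \<le> dual_norm N (r *\<^sub>R \<alpha>) / r"
      using inner_le_dual_norm_unit[OF assms(1), of x "r *\<^sub>R \<alpha>"] assms(2) by (simp add: field_simps)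
  qed
  then show "r * dual_norm N \<alpha> \<le> dual_norm N (r *\<^sub>R \<alpha>)" using assms(2) by (simp add: field_simps)
qed

lemma inner_le_l1_norm_infnorm: "y \<bullet> b \<le> l1_norm y * infnorm b"
proof -
  have "y \<bullet> b = (\<Sum>t\<in>UNIV. y $ t * b $ t)" by (simp add: inner_vec_def)
  also have "\<dots> \<le> (\<Sum>t\<in>UNIV. \<bar>y $ t\<bar> * infnorm b)"
  proof (rule sum_mono)
    fix t
    have "y $ t * b $ t \<le> \<bar>y $ t\<bar> * \<bar>b $ t\<bar>" by (metis abs_ge_self abs_mult)
    also have "\<dots> \<le> \<bar>y $ t\<bar> * infnorm b"
      by (intro mult_left_mono component_le_infnorm_cart) simp
    finally show "y $ t * b $ t \<le> \<bar>y $ t\<bar> * infnorm b" .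
  qed
  finally show ?thesis by (simp add: l1_norm_def sum_distrib_right)
qed

text \<open>Together with the preceding inequality this makes \<open>l1_norm\<close> the dual norm of \<open>infnorm\<close>; the
  supremum is attained at the vector of signs.\<close>

lemma l1_norm_attained:
  obtains v where "infnorm v \<le> 1" "y \<bullet> v = l1_norm y"
proof
  show "infnorm (\<chi> t. sgn (y $ t)) \<le> 1"
    unfolding infnorm_cart by (rule cSup_least) (auto simp: abs_sgn_eq)
  show "y \<bullet> (\<chi> t. sgn (y $ t)) = l1_norm y"
    by (simp add: inner_vec_def l1_norm_def abs_sgn)
qed

lemma l1_norm_nonneg: "0 \<le> l1_norm y"
  by (simp add: l1_norm_def sum_nonneg)

lemma l1_norm_scaleR: "l1_norm (r *\<^sub>R y) = \<bar>r\<bar> * l1_norm y"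
  by (simp add: l1_norm_def abs_mult sum_distrib_left)

lemma l1_norm_triangle: "l1_norm (x + y) \<le> l1_norm x + l1_norm y"
  by (simp add: l1_norm_def abs_triangle_ineq sum_mono flip: sum.distrib)

section \<open>Polyhedra near one of their points\<close>

text \<open>An inequality that is strict at \<open>w0\<close> stays valid up to the distance of \<open>w0\<close> from its bounding
  hyperplane. Below the smallest of these finitely many distances only the active inequalities
  matter, and their normals form \<open>A\<close>.\<close>

lemma polyhedron_eq_tangent_cone_locally:
  fixes P :: "'a::euclidean_space set"
  assumes "polyhedron P" "w0 \<in> P"
  obtains A r where "0 < r" "\<And>w u. w \<in> P \<Longrightarrow> u \<in> A \<Longrightarrow> u \<bullet> (w - w0) \<le> 0"
    "\<And>w. norm (w - w0) < r \<Longrightarrow> (\<And>u. u \<in> A \<Longrightarrow> u \<bullet> (w - w0) \<le> 0) \<Longrightarrow> w \<in> P"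
proof -
  obtain F where F: "finite F" "P = \<Inter>F" "\<forall>h\<in>F. \<exists>a b. a \<noteq> 0 \<and> h = {x. a \<bullet> x \<le> b}"
    using assms(1) unfolding polyhedron_def by blast
  then obtain n \<beta> where n: "\<And>h. h \<in> F \<Longrightarrow> n h \<noteq> 0 \<and> h = {x. n h \<bullet> x \<le> \<beta> h}"
    by metis
  have mem: "w \<in> P \<longleftrightarrow> (\<forall>h\<in>F. n h \<bullet> w \<le> \<beta> h)" for w
    using n unfolding F(2) by blast
  define I where "I = {h\<in>F. n h \<bullet> w0 < \<beta> h}"
  define \<delta> where "\<delta> h = (\<beta> h - n h \<bullet> w0) / norm (n h)" for h
  \<comment> \<open>The element 1 covers the case that all inequalities are active.\<close>
  define r where "r = Min (insert 1 (\<delta> ` I))"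
  have fin: "finite (insert 1 (\<delta> ` I))" using F(1) by (simp add: I_def)
  have "0 < r" unfolding r_def using fin n by (auto simp: I_def \<delta>_def)
  show ?thesis
  proof (rule that[OF \<open>0 < r\<close>, of "n ` (F - I)"])
    have active: "n h \<bullet> w0 = \<beta> h" if "h \<in> F - I" for h
      using that assms(2) mem[of w0] unfolding I_def by force
    {
      fix w u assume "w \<in> P" "u \<in> n ` (F - I)"
      then show "u \<bullet> (w - w0) \<le> 0"
        using active mem[of w] by (auto simp: inner_diff_right)
    next
      fix w assume w: "norm (w - w0) < r" "\<And>u. u \<in> n ` (F - I) \<Longrightarrow> u \<bullet> (w - w0) \<le> 0"
      have "n h \<bullet> w \<le> \<beta> h" if "h \<in> F" for h
      proof (cases "h \<in> I")
        case True
        have "n h \<bullet> (w - w0) \<le> norm (n h) * norm (w - w0)" by (rule norm_cauchy_schwarz)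
        also have "\<dots> \<le> norm (n h) * \<delta> h"
          using w(1) fin True by (intro mult_left_mono) (auto simp: r_def)
        also have "\<dots> = \<beta> h - n h \<bullet> w0" using n[OF that] by (simp add: \<delta>_def)
        finally show ?thesis by (simp add: inner_diff_right)
      next
        case False
        then show ?thesis using active[of h] w(2)[of "n h"] that by (simp add: inner_diff_right)
      qed
      then show "w \<in> P" using mem by blast
    }
  qed
qed

section \<open>The coderivative criterion for polyhedral graphs\<close>

lemma coderivative_iff:
  "y \<in> coderivative M b0 p0 \<alpha> \<longleftrightarrow> (\<forall>(b, p) \<in> gph M. y \<bullet> (b - b0) \<le> \<alpha> \<bullet> (p - p0))"
  by (auto simp: coderivative_def normal_cone_def)

text \<open>Moving the parameter from \<open>b0\<close> in the direction in which \<open>y\<close> attains its norm must be followed,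
  up to an arbitrarily small error, by a value at distance at most \<open>l\<close> times the step. The normal
  inequality at this nearby point of the graph is the claimed bound.\<close>

lemma coderivative_bound_of_lip_constant:
  fixes M :: "real ^ 'm \<Rightarrow> 'b::euclidean_space set"
  assumes N: "is_norm N" and b0: "(b0, p0) \<in> gph M"
    and lip: "lip_constant (\<lambda>b b'. infnorm (b - b')) (\<lambda>p p'. N (p - p')) M b0 p0 l"
    and y: "y \<in> coderivative M b0 p0 \<alpha>"
  shows "l1_norm y \<le> l * dual_norm N \<alpha>"
proof -
  obtain U V where "0 \<le> l" and U: "nbhd (\<lambda>b b'. infnorm (b - b')) b0 U"
    and V: "nbhd (\<lambda>p p'. N (p - p')) p0 V"
    and UV: "\<And>b b' p. b \<in> U \<Longrightarrow> b' \<in> U \<Longrightarrow> p \<in> V \<Longrightarrow> p \<in> M b \<Longrightarrow>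
      dist_to_set (\<lambda>p p'. N (p - p')) p (M b') \<le> ereal (l * infnorm (b - b'))"
    using lip unfolding lip_constant_def by blast
  obtain r where r: "0 < r" "{b'. infnorm (b0 - b') < r} \<subseteq> U" using U unfolding nbhd_def by blast
  have "b0 \<in> U" using r by (auto simp: infnorm_0)
  have "p0 \<in> V"
  proof -
    obtain s where "0 < s" "{p'. N (p0 - p') < s} \<subseteq> V" using V unfolding nbhd_def by blast
    moreover have "N (p0 - p0) = 0" using is_norm_eq_0_iff[OF N, of 0] by simp
    ultimately show ?thesis by auto
  qed
  have D: "0 \<le> dual_norm N \<alpha>"
    using inner_le_dual_norm_unit[OF N, of 0 \<alpha>] is_norm_eq_0_iff[OF N, of 0] by simp
  obtain v where v: "infnorm v \<le> 1" "y \<bullet> v = l1_norm y" by (rule l1_norm_attained)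
  define s where "s = r / 2"
  define b where "b = b0 + s *\<^sub>R v"
  have "0 < s" using r by (simp add: s_def)
  have bb0: "infnorm (b0 - b) \<le> s"
    using v \<open>0 < s\<close> by (simp add: b_def infnorm_neg infnorm_mul)
  also have "s < r" using r by (simp add: s_def)
  finally have "b \<in> U" using r by blast
  have "p0 \<in> M b0" using b0 by (simp add: gph_def)
  have "dist_to_set (\<lambda>p p'. N (p - p')) p0 (M b) \<le> ereal (l * infnorm (b0 - b))"
    by (rule UV) fact+
  also have "\<dots> \<le> ereal (l * s)" using bb0 \<open>0 \<le> l\<close> by (simp add: mult_left_mono)
  finally have dist: "dist_to_set (\<lambda>p p'. N (p - p')) p0 (M b) \<le> ereal (l * s)" .
  have "s * l1_norm y \<le> s * (l * dual_norm N \<alpha>)"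
  proof (rule field_le_epsilon)
    fix e :: real assume "0 < e"
    \<comment> \<open>The summand 1 avoids a division by zero for \<open>\<alpha> = 0\<close>.\<close>
    define \<epsilon> where "\<epsilon> = e / (dual_norm N \<alpha> + 1)"
    have "0 < \<epsilon>" using D \<open>0 < e\<close> by (simp add: \<epsilon>_def)
    then have "dist_to_set (\<lambda>p p'. N (p - p')) p0 (M b) < ereal (l * s + \<epsilon>)"
      using dist by (simp add: le_less_trans)
    then obtain p where p: "p \<in> M b" "N (p0 - p) < l * s + \<epsilon>"
      unfolding dist_to_set_def INF_less_iff by auto
    have "s * l1_norm y = y \<bullet> (b - b0)" by (simp add: b_def v)
    also have "\<dots> \<le> \<alpha> \<bullet> (p - p0)"
      using y p(1) unfolding coderivative_iff by (auto simp: gph_def)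
    also have "\<dots> \<le> dual_norm N \<alpha> * N (p - p0)" by (rule inner_le_dual_norm[OF N])
    also have "\<dots> \<le> dual_norm N \<alpha> * (l * s + \<epsilon>)"
      using D p(2) by (intro mult_left_mono) (simp_all add: is_norm_minus_commute[OF N])
    also have "\<dots> = s * (l * dual_norm N \<alpha>) + dual_norm N \<alpha> * \<epsilon>" by (simp add: algebra_simps)
    also have "dual_norm N \<alpha> * \<epsilon> \<le> e"
      using D \<open>0 < e\<close> by (simp add: \<epsilon>_def field_simps)
    finally show "s * l1_norm y \<le> s * (l * dual_norm N \<alpha>) + e" by simp
  qed
  then show ?thesis using \<open>0 < s\<close> by simp
qed

text \<open>The Lipschitz estimate is first proved for the tangent cone \<open>K\<close> in place of the graph, where
  it holds globally. If it failed for \<open>p\<close> and \<open>b'\<close>, the ball of radius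
  \<open>d = l * infnorm (b - b')\<close> around \<open>p\<close>, taken over the parameter \<open>b'\<close>, would be
  strictly separated from \<open>K\<close> by a functional \<open>(y, - \<alpha>)\<close>. As \<open>K\<close> is a cone, this functional is
  nonpositive on \<open>K\<close>, hence normal to the graph, while on the ball it shows
  \<open>d * dual_norm N \<alpha> < y \<bullet> (b' - b)\<close>, against the assumed bound. Since every point produced in this
  way lies close to \<open>(b0, p0)\<close>, where \<open>K\<close> and the graph agree, it belongs to the graph.\<close>

lemma lip_constant_of_coderivative_bound:
  fixes M :: "real ^ 'm \<Rightarrow> 'b::euclidean_space set"
  assumes N: "is_norm N" and poly: "polyhedron (gph M)" and b0: "(b0, p0) \<in> gph M"
    and "0 \<le> l"
    and bound: "\<And>y \<alpha>. y \<in> coderivative M b0 p0 \<alpha> \<Longrightarrow> l1_norm y \<le> l * dual_norm N \<alpha>"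
  shows "lip_constant (\<lambda>b b'. infnorm (b - b')) (\<lambda>p p'. N (p - p')) M b0 p0 l"
proof -
  obtain A r where "0 < r"
    and tangent: "\<And>w u. w \<in> gph M \<Longrightarrow> u \<in> A \<Longrightarrow> u \<bullet> (w - (b0, p0)) \<le> 0"
    and local: "\<And>w. norm (w - (b0, p0)) < r \<Longrightarrow>
      (\<And>u. u \<in> A \<Longrightarrow> u \<bullet> (w - (b0, p0)) \<le> 0) \<Longrightarrow> w \<in> gph M"
    using polyhedron_eq_tangent_cone_locally[OF poly b0] by metis
  define K where "K = (\<Inter>u\<in>A. {v. u \<bullet> v \<le> 0})"
  have K: "convex K" "closed K" "convex_cone K"
    unfolding K_def
    by (auto intro!: convex_INT closed_INT convex_halfspace_le closed_halfspace_le
        convex_cone_Inter convex_cone_halfspace_le)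
  have gph_K: "w - (b0, p0) \<in> K" if "w \<in> gph M" for w
    using tangent[OF that] by (auto simp: K_def)
  \<comment> \<open>In the tangent cone the estimate holds without any restriction on \<open>b'\<close>.\<close>
  have step: "\<exists>p'. (b' - b0, p' - p0) \<in> K \<and> N (p' - p) \<le> l * infnorm (b - b')"
    if bp: "(b, p) \<in> gph M" for b b' p
  proof (rule ccontr)
    define d where "d = l * infnorm (b - b')"
    have "0 \<le> d" using \<open>0 \<le> l\<close> by (simp add: d_def infnorm_pos_le)
    define B where "B = {b' - b0} \<times> {z. N (z - (p - p0)) \<le> d}"
    assume no: "\<not> ?thesis"
    have "K \<inter> B = {}"
    proof (rule ccontr)
      assume "K \<inter> B \<noteq> {}"
      then obtain z where "(b' - b0, z) \<in> K" "N (z - (p - p0)) \<le> d" unfolding B_def by blast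
      then have "(b' - b0, (z + p0) - p0) \<in> K \<and> N ((z + p0) - p) \<le> d" by (simp add: algebra_simps)
      then show False using no unfolding d_def by blast
    qed
    moreover have "compact B" "convex B"
      unfolding B_def using compact_is_norm_ball[OF N] convex_is_norm_ball[OF N]
      by (auto intro!: compact_Times convex_Times)
    moreover have "B \<noteq> {}"
    proof -
      have "(b' - b0, p - p0) \<in> B" using \<open>0 \<le> d\<close> is_norm_eq_0_iff[OF N, of 0] by (simp add: B_def)
      then show ?thesis by blast
    qed
    ultimately obtain \<eta> \<beta> where sep: "\<And>k. k \<in> K \<Longrightarrow> \<eta> \<bullet> k < \<beta>" "\<And>k. k \<in> B \<Longrightarrow> \<beta> < \<eta> \<bullet> k"
      using separating_hyperplane_closed_compact[OF K(1,2)] by metis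
    have "0 < \<beta>" using sep(1)[OF convex_cone_contains_0[OF K(3)]] by simp
    have neg: "\<eta> \<bullet> k \<le> 0" if "k \<in> K" for k
    proof (rule ccontr)
      assume "\<not> \<eta> \<bullet> k \<le> 0"
      then have "\<eta> \<bullet> ((\<beta> / (\<eta> \<bullet> k)) *\<^sub>R k) = \<beta>" "0 \<le> \<beta> / (\<eta> \<bullet> k)" using \<open>0 < \<beta>\<close> by auto
      then show False using sep(1) convex_cone_scaleR[OF K(3) _ that] by (metis less_irrefl)
    qed
    obtain y \<alpha> where \<eta>: "\<eta> = (y, - \<alpha>)" by (metis minus_minus surj_pair)
    have "y \<in> coderivative M b0 p0 \<alpha>"
      unfolding coderivative_iff
    proof safe
      fix b p assume "(b, p) \<in> gph M"
      then show "y \<bullet> (b - b0) \<le> \<alpha> \<bullet> (p - p0)" using neg[OF gph_K] by (force simp: \<eta>)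
    qed
    then have ly: "l1_norm y \<le> l * dual_norm N \<alpha>" by (rule bound)
    have bp': "y \<bullet> (b - b0) \<le> \<alpha> \<bullet> (p - p0)" using neg[OF gph_K[OF bp]] by (simp add: \<eta>)
    have unit: "d * (\<alpha> \<bullet> u) < y \<bullet> (b' - b) - \<beta>" if "N u \<le> 1" for u
    proof -
      have "N (d *\<^sub>R u) \<le> d"
        using that \<open>0 \<le> d\<close> by (simp add: is_norm_scaleR[OF N] mult_left_le)
      then have "(b' - b0, (p - p0) + d *\<^sub>R u) \<in> B" by (simp add: B_def)
      from sep(2)[OF this] bp' show ?thesis by (simp add: \<eta> inner_diff_right inner_add_right)
    qed
    have "d * dual_norm N \<alpha> \<le> y \<bullet> (b' - b) - \<beta>"
    proof (cases "d = 0")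
      case True
      then show ?thesis using unit[of 0] is_norm_eq_0_iff[OF N, of 0] by simp
    next
      case False
      then have "dual_norm N \<alpha> \<le> (y \<bullet> (b' - b) - \<beta>) / d"
        using unit \<open>0 \<le> d\<close> by (intro dual_norm_le[OF N]) (simp add: field_simps less_imp_le)
      then show ?thesis using False \<open>0 \<le> d\<close> by (simp add: field_simps)
    qed
    moreover have "y \<bullet> (b' - b) \<le> l1_norm y * infnorm (b - b')"
      using inner_le_l1_norm_infnorm[of y "b' - b"] by (simp add: infnorm_sub)
    moreover have "l1_norm y * infnorm (b - b') \<le> (l * dual_norm N \<alpha>) * infnorm (b - b')"
      using ly by (intro mult_right_mono infnorm_pos_le)
    ultimately show False using \<open>0 < \<beta>\<close> by (simp add: d_def algebra_simps)
  qed
  \<comment> \<open>The radius \<open>s\<close> of both neighbourhoods: if \<open>b\<close>, \<open>b'\<close> and \<open>p\<close> are within \<open>s\<close> of the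
    reference point, then \<open>p'\<close> is within \<open>(2 * l + 1) * s\<close> of \<open>p0\<close>; \<open>m\<close> and \<open>k\<close> convert to
    Euclidean norms.\<close>
  obtain k where k: "0 < k" "\<And>x::'b. norm x \<le> k * N x" using norm_le_is_norm[OF N] by blast
  define m where "m = sqrt DIM(real ^ 'm)"
  define D where "D = m + k * (2 * l + 1)"
  define s where "s = r / (2 * D)"
  have "0 \<le> m" by (simp add: m_def)
  have "0 < D" using \<open>0 \<le> m\<close> k(1) \<open>0 \<le> l\<close> by (simp add: D_def add_nonneg_pos)
  then have "0 < s" and "D * s < r"
    using \<open>0 < r\<close> by (simp_all add: s_def)
  then have s: "m * s + k * ((2 * l + 1) * s) < r" by (simp add: D_def algebra_simps)
  define U where "U = {b. infnorm (b0 - b) < s}"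
  define V where "V = {p. N (p0 - p) < s}"
  have "dist_to_set (\<lambda>p p'. N (p - p')) p (M b') \<le> ereal (l * infnorm (b - b'))"
    if "b \<in> U" "b' \<in> U" "p \<in> V" and pM: "p \<in> M b" for b b' p
  proof -
    obtain p' where p': "(b' - b0, p' - p0) \<in> K" "N (p' - p) \<le> l * infnorm (b - b')"
      using step[of b p b'] pM by (auto simp: gph_def)
    have "infnorm (b - b') \<le> infnorm (b - b0) + infnorm (b0 - b')"
      using infnorm_triangle[of "b - b0" "b0 - b'"] by simp
    then have "infnorm (b - b') \<le> 2 * s"
      using that(1,2) infnorm_sub[of b b0] by (simp add: U_def)
    then have "N (p' - p) \<le> l * (2 * s)"
      using p'(2) \<open>0 \<le> l\<close> by (meson mult_left_mono order_trans)
    moreover have "N (p' - p0) \<le> N (p' - p) + N (p - p0)"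
      using is_norm_triangle[OF N, of "p' - p" "p - p0"] by simp
    moreover have "N (p - p0) \<le> s" using that(3) is_norm_minus_commute[OF N, of p p0] by (simp add: V_def)
    ultimately have "N (p' - p0) \<le> (2 * l + 1) * s" by (simp add: algebra_simps)
    then have "norm (p' - p0) \<le> k * ((2 * l + 1) * s)"
      using k mult_left_mono[of "N (p' - p0)" "(2 * l + 1) * s" k] by (meson less_imp_le order_trans)
    moreover have "norm (b' - b0) \<le> m * s"
    proof -
      have "norm (b' - b0) \<le> m * infnorm (b' - b0)" unfolding m_def by (rule norm_le_infnorm)
      also have "\<dots> \<le> m * s"
        using that(2) \<open>0 \<le> m\<close> infnorm_sub[of b' b0] by (intro mult_left_mono) (simp_all add: U_def)
      finally show ?thesis .
    qed
    moreover have "norm ((b', p') - (b0, p0)) \<le> norm (b' - b0) + norm (p' - p0)"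
      using norm_Pair_le[of "b' - b0" "p' - p0"] by simp
    ultimately have "norm ((b', p') - (b0, p0)) < r" using s by linarith
    then have "(b', p') \<in> gph M" using p'(1) by (intro local) (auto simp: K_def)
    then have "dist_to_set (\<lambda>p p'. N (p - p')) p (M b') \<le> ereal (N (p - p'))"
      unfolding dist_to_set_def by (intro INF_lower) (simp add: gph_def)
    also have "\<dots> \<le> ereal (l * infnorm (b - b'))"
      using p'(2) is_norm_minus_commute[OF N, of p p'] by simp
    finally show ?thesis .
  qed
  moreover have "nbhd (\<lambda>b b'. infnorm (b - b')) b0 U" "nbhd (\<lambda>p p'. N (p - p')) p0 V"
    unfolding nbhd_def U_def V_def using \<open>0 < s\<close> by blast+
  ultimately show ?thesis unfolding lip_constant_def using \<open>0 \<le> l\<close> by blast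
qed

section \<open>The epigraph of the multiobjective problem\<close>

text \<open>In contrast to the epigraphical Pareto front mapping this refers to all feasible points, not
  only to efficient ones, and is therefore visibly the projection of a polyhedral cone.\<close>

definition objective_epigraph ::
    "('m::finite \<Rightarrow> real ^ 'n) \<Rightarrow> ('q::finite \<Rightarrow> real ^ 'n) \<Rightarrow> ((real ^ 'm) \<times> (real ^ 'q)) set" where
  "objective_epigraph a c = {(b, p). \<exists>x\<in>feasible_set a b. \<forall>i. c i \<bullet> x \<le> p $ i}"

lemma objective_epigraph_upward:
  "(b, p) \<in> objective_epigraph a c \<Longrightarrow> r \<in> nonneg_orthant \<Longrightarrow> (b, p + r) \<in> objective_epigraph a c"
  unfolding objective_epigraph_def nonneg_orthant_def by simp (meson add_increasing2)

lemma convex_cone_sum: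
  assumes "convex_cone K" "finite I" "\<And>i. i \<in> I \<Longrightarrow> f i \<in> K" shows "sum f I \<in> K"
  using assms(2,3)
  by (induction I rule: finite_induct)
     (simp_all add: convex_cone_add[OF assms(1)] convex_cone_contains_0[OF assms(1)])

text \<open>With \<open>f x\<close> the vector of all constraint and objective values at \<open>x\<close>, the set consists of the
  points \<open>f x + k\<close> with \<open>k \<ge> 0\<close>. It is generated as a convex cone by the vectors \<open>f e\<close> and \<open>- f e\<close>
  for basis vectors \<open>e\<close> together with the unit vectors, and finitely generated cones are
  polyhedral.\<close>

lemma polyhedron_objective_epigraph:
  fixes a :: "'m::finite \<Rightarrow> real ^ 'n" and c :: "'q::finite \<Rightarrow> real ^ 'n"
  shows "polyhedron (objective_epigraph a c)"
proof -
  define f :: "real ^ 'n \<Rightarrow> (real ^ 'm) \<times> (real ^ 'q)"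
    where "f x = (\<chi> t. a t \<bullet> x, \<chi> i. c i \<bullet> x)" for x
  have f: "linear f"
    by (rule linearI) (simp_all add: f_def vec_eq_iff inner_add_right)
  define S :: "((real ^ 'm) \<times> (real ^ 'q)) set" where
    "S = f ` Basis \<union> (\<lambda>e. - f e) ` Basis \<union> (\<lambda>t. (axis t 1, 0)) ` UNIV \<union> (\<lambda>i. (0, axis i 1)) ` UNIV"
  have "objective_epigraph a c = convex_cone hull S"
  proof
    have "convex_cone (objective_epigraph a c)"
      unfolding convex_cone_iff
    proof safe
      show "0 \<in> objective_epigraph a c"
        by (auto simp: objective_epigraph_def feasible_set_def zero_prod_def intro!: exI[of _ 0])
    next
      fix b p b' p'
      assume "(b, p) \<in> objective_epigraph a c" "(b', p') \<in> objective_epigraph a c"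
      then obtain x x' where "x \<in> feasible_set a b" "\<forall>i. c i \<bullet> x \<le> p $ i"
        "x' \<in> feasible_set a b'" "\<forall>i. c i \<bullet> x' \<le> p' $ i"
        by (auto simp: objective_epigraph_def)
      then show "(b, p) + (b', p') \<in> objective_epigraph a c"
        by (auto simp: objective_epigraph_def feasible_set_def inner_add_right
            intro!: exI[of _ "x + x'"] add_mono)
    next
      fix b p and r :: real
      assume "(b, p) \<in> objective_epigraph a c" "0 \<le> r"
      then obtain x where "x \<in> feasible_set a b" "\<forall>i. c i \<bullet> x \<le> p $ i"
        by (auto simp: objective_epigraph_def)
      then show "r *\<^sub>R (b, p) \<in> objective_epigraph a c"
        using \<open>0 \<le> r\<close> by (auto simp: objective_epigraph_def feasible_set_def
            intro!: exI[of _ "r *\<^sub>R x"] mult_left_mono)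
    qed
    moreover have "S \<subseteq> objective_epigraph a c"
    proof -
      have "f x \<in> objective_epigraph a c" for x
        by (auto simp: objective_epigraph_def feasible_set_def f_def intro!: exI[of _ x])
      moreover from this have "- f x \<in> objective_epigraph a c" for x
        by (metis linear_neg[OF f])
      moreover have "(axis t 1, 0) \<in> objective_epigraph a c" for t
        by (auto simp: objective_epigraph_def feasible_set_def axis_def intro!: exI[of _ 0])
      moreover have "(0, axis i 1) \<in> objective_epigraph a c" for i
        by (auto simp: objective_epigraph_def feasible_set_def axis_def intro!: exI[of _ 0])
      ultimately show ?thesis unfolding S_def by blast
    qed
    ultimately show "convex_cone hull S \<subseteq> objective_epigraph a c" by (simp add: hull_minimal)
  next
    have cc: "convex_cone (convex_cone hull S)" by (rule convex_cone_convex_cone_hull)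
    have S: "s \<in> convex_cone hull S" if "s \<in> S" for s using that by (rule hull_inc)
    show "objective_epigraph a c \<subseteq> convex_cone hull S"
    proof safe
      fix b p assume "(b, p) \<in> objective_epigraph a c"
      then obtain x where x: "\<And>t. a t \<bullet> x \<le> b $ t" "\<And>i. c i \<bullet> x \<le> p $ i"
        by (auto simp: objective_epigraph_def feasible_set_def)
      have "(x \<bullet> e) *\<^sub>R f e \<in> convex_cone hull S" if "e \<in> Basis" for e
      proof (cases "0 \<le> x \<bullet> e")
        case True
        then show ?thesis using that by (intro convex_cone_scaleR[OF cc] S) (auto simp: S_def)
      next
        case False
        then have "(- (x \<bullet> e)) *\<^sub>R (- f e) \<in> convex_cone hull S"
          using that by (intro convex_cone_scaleR[OF cc] S) (auto simp: S_def)
        then show ?thesis by simp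
      qed
      moreover have "f x = (\<Sum>e\<in>Basis. (x \<bullet> e) *\<^sub>R f e)"
        by (subst euclidean_representation[of x, symmetric])
           (simp only: linear_sum[OF f] linear_scale[OF f])
      ultimately have "f x \<in> convex_cone hull S" by (simp add: convex_cone_sum[OF cc])
      moreover have "(\<Sum>t\<in>UNIV. (b $ t - a t \<bullet> x) *\<^sub>R (axis t 1, 0)) \<in> convex_cone hull S"
        using x(1) by (intro convex_cone_sum[OF cc] convex_cone_scaleR[OF cc] S) (auto simp: S_def)
      moreover have "(\<Sum>i\<in>UNIV. (p $ i - c i \<bullet> x) *\<^sub>R (0, axis i 1)) \<in> convex_cone hull S"
        using x(2) by (intro convex_cone_sum[OF cc] convex_cone_scaleR[OF cc] S) (auto simp: S_def)
      moreover have "(b, p) = f x + (\<Sum>t\<in>UNIV. (b $ t - a t \<bullet> x) *\<^sub>R (axis t 1, 0))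
          + (\<Sum>i\<in>UNIV. (p $ i - c i \<bullet> x) *\<^sub>R (0, axis i 1))"
      proof (rule prod_eqI)
        show "fst (b, p) = fst (f x + (\<Sum>t\<in>UNIV. (b $ t - a t \<bullet> x) *\<^sub>R (axis t 1, 0))
          + (\<Sum>i\<in>UNIV. (p $ i - c i \<bullet> x) *\<^sub>R (0, axis i 1)))"
          by (simp add: f_def fst_sum vec_eq_iff axis_def if_distrib cong: if_cong)
        show "snd (b, p) = snd (f x + (\<Sum>t\<in>UNIV. (b $ t - a t \<bullet> x) *\<^sub>R (axis t 1, 0))
          + (\<Sum>i\<in>UNIV. (p $ i - c i \<bullet> x) *\<^sub>R (0, axis i 1)))"
          by (simp add: f_def snd_sum vec_eq_iff axis_def if_distrib cong: if_cong)
      qed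
      ultimately show "(b, p) \<in> convex_cone hull S"
        by (simp only: convex_cone_add[OF cc])
    qed
  qed
  moreover have "finite S" by (simp add: S_def)
  ultimately show ?thesis by (simp add: polyhedron_convex_cone_hull)
qed

lemma pareto_front_subset_objective_epigraph:
  "p \<in> pareto_front a c b \<Longrightarrow> (b, p) \<in> objective_epigraph a c"
  by (auto simp: pareto_front_def efficient_set_def objective_epigraph_def)

lemma pareto_front_minimal:
  assumes p: "p \<in> pareto_front a c b" and p': "(b, p') \<in> objective_epigraph a c"
    and le: "\<And>i. p' $ i \<le> p $ i"
  shows "p' = p"
proof -
  obtain x where x: "x \<in> efficient_set a c b" "p = (\<chi> i. c i \<bullet> x)"
    using p by (auto simp: pareto_front_def)
  obtain x' where x': "x' \<in> feasible_set a b" "\<And>i. c i \<bullet> x' \<le> p' $ i"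
    using p' by (auto simp: objective_epigraph_def)
  have "c i \<bullet> x' \<le> c i \<bullet> x" for i using x'(2)[of i] le[of i] x(2) by simp
  then have "\<not> c i \<bullet> x' < c i \<bullet> x" for i
    using x(1) x'(1) unfolding efficient_set_def by blast
  then have "c i \<bullet> x \<le> p' $ i" for i using x'(2)[of i] by (meson not_less order_trans)
  then have "p $ i \<le> p' $ i" for i by (simp add: x(2))
  then show ?thesis using le by (simp add: vec_eq_iff order_antisym)
qed

lemma normal_at_objective_epigraph_nonneg:
  assumes "(b0, p0) \<in> objective_epigraph a c"
    and "\<And>b p. (b, p) \<in> objective_epigraph a c \<Longrightarrow> y \<bullet> (b - b0) \<le> \<alpha> \<bullet> (p - p0)"
  shows "\<alpha> \<in> nonneg_orthant"
proof -
  have "0 \<le> \<alpha> $ i" for i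
  proof -
    have "axis i 1 \<in> nonneg_orthant" by (simp add: nonneg_orthant_def axis_def)
    from assms(2)[OF objective_epigraph_upward[OF assms(1) this]] show ?thesis
      by (simp add: inner_axis)
  qed
  then show ?thesis by (simp add: nonneg_orthant_def)
qed

text \<open>This is the geometric form of the fact that in a linear problem every efficient point
  minimises a combination of the objectives with strictly positive weights. Decreasing the \<open>i\<close>-th
  coordinate of \<open>p0\<close> leaves the polyhedron, so some inequality active at \<open>(b0, p0)\<close> is violated; its
  \<open>p\<close>-component is positive at \<open>i\<close> and nonnegative elsewhere. The sum over \<open>i\<close> is positive
  everywhere.\<close>

lemma strictly_positive_normal_at_pareto_point:
  fixes a :: "'m::finite \<Rightarrow> real ^ 'n" and c :: "'q::finite \<Rightarrow> real ^ 'n"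
  assumes p0: "p0 \<in> pareto_front a c b0"
  obtains y \<alpha> where "\<And>i. 0 < \<alpha> $ i"
    "\<And>b p. (b, p) \<in> objective_epigraph a c \<Longrightarrow> y \<bullet> (b - b0) \<le> \<alpha> \<bullet> (p - p0)"
proof -
  let ?G = "objective_epigraph a c"
  have mem: "(b0, p0) \<in> ?G" using p0 by (rule pareto_front_subset_objective_epigraph)
  obtain A r where "0 < r" and tangent: "\<And>w u. w \<in> ?G \<Longrightarrow> u \<in> A \<Longrightarrow> u \<bullet> (w - (b0, p0)) \<le> 0"
    and local: "\<And>w. norm (w - (b0, p0)) < r \<Longrightarrow>
      (\<And>u. u \<in> A \<Longrightarrow> u \<bullet> (w - (b0, p0)) \<le> 0) \<Longrightarrow> w \<in> ?G"
    using polyhedron_eq_tangent_cone_locally[OF polyhedron_objective_epigraph mem] by metis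
  have "\<exists>y \<alpha>. \<alpha> \<in> nonneg_orthant \<and> 0 < \<alpha> $ i \<and> (\<forall>b p. (b, p) \<in> ?G \<longrightarrow> y \<bullet> (b - b0) \<le> \<alpha> \<bullet> (p - p0))"
    for i
  proof -
    define p where "p = p0 - (r / 2) *\<^sub>R axis i 1"
    have "p $ i < p0 $ i" using \<open>0 < r\<close> by (simp add: p_def axis_def)
    moreover have "p $ j \<le> p0 $ j" for j using \<open>0 < r\<close> by (simp add: p_def axis_def)
    ultimately have "(b0, p) \<notin> ?G" using pareto_front_minimal[OF p0] by force
    moreover have "norm ((b0, p) - (b0, p0)) < r"
      using \<open>0 < r\<close> by (simp add: p_def norm_Pair)
    ultimately obtain u where u: "u \<in> A" "0 < u \<bullet> ((b0, p) - (b0, p0))"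
      using local by (meson not_less)
    obtain y \<alpha> where y: "u = (y, - \<alpha>)" by (metis minus_minus surj_pair)
    have normal: "y \<bullet> (b - b0) \<le> \<alpha> \<bullet> (p - p0)" if "(b, p) \<in> ?G" for b p
      using tangent[OF that u(1)] by (simp add: y)
    moreover have "0 < \<alpha> $ i"
      using u(2) \<open>0 < r\<close> by (simp add: y p_def inner_axis zero_less_mult_iff)
    ultimately show ?thesis using normal_at_objective_epigraph_nonneg[OF mem normal] by blast
  qed
  then obtain y \<alpha> where \<alpha>: "\<And>i. \<alpha> i \<in> nonneg_orthant" "\<And>i. 0 < \<alpha> i $ i"
    and y: "\<And>i b p. (b, p) \<in> ?G \<Longrightarrow> y i \<bullet> (b - b0) \<le> \<alpha> i \<bullet> (p - p0)"
    by metis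
  show ?thesis
  proof
    fix i
    have "0 < (\<Sum>j\<in>UNIV. \<alpha> j $ i)"
      by (rule sum_pos2[where i = i]) (use \<alpha> in \<open>auto simp: nonneg_orthant_def\<close>)
    then show "0 < (\<Sum>j\<in>UNIV. \<alpha> j) $ i" by simp
  next
    fix b p assume "(b, p) \<in> ?G"
    then show "(\<Sum>j\<in>UNIV. y j) \<bullet> (b - b0) \<le> (\<Sum>j\<in>UNIV. \<alpha> j) \<bullet> (p - p0)"
      by (simp add: inner_sum_left sum_mono y)
  qed
qed

text \<open>The strictly positive normal found at \<open>(b0, p0)\<close> bounds \<open>\<alpha> \<bullet> p'\<close> from below for every
  parameter \<open>b\<close>. The set \<open>Q\<close> of attainable \<open>p'\<close> below \<open>p\<close> is therefore compact, and since all
  weights are positive, a minimiser of \<open>\<alpha> \<bullet> p'\<close> over \<open>Q\<close> is Pareto minimal.\<close>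

lemma domination_property:
  fixes a :: "'m::finite \<Rightarrow> real ^ 'n" and c :: "'q::finite \<Rightarrow> real ^ 'n"
  assumes p0: "p0 \<in> pareto_front a c b0" and bp: "(b, p) \<in> objective_epigraph a c"
  obtains p' where "p' \<in> pareto_front a c b" "\<And>i. p' $ i \<le> p $ i"
proof -
  let ?G = "objective_epigraph a c"
  obtain y \<alpha> where \<alpha>: "\<And>i. 0 < \<alpha> $ i"
    and y: "\<And>b p. (b, p) \<in> ?G \<Longrightarrow> y \<bullet> (b - b0) \<le> \<alpha> \<bullet> (p - p0)"
    using strictly_positive_normal_at_pareto_point[OF p0] by metis
  define Q where "Q = {p'. (b, p') \<in> ?G \<and> (\<forall>i. p' $ i \<le> p $ i)}"
  have "closed Q"
  proof -
    have "Q = Pair b -` ?G \<inter> (\<Inter>i. {p'. p' $ i \<le> p $ i})" by (auto simp: Q_def)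
    moreover have "closed (Pair b -` ?G)"
      by (intro closed_vimage continuous_intros polyhedron_imp_closed polyhedron_objective_epigraph)
    moreover have "closed {p'. p' $ i \<le> p $ i}" for i
      by (intro closed_Collect_le continuous_intros)
    ultimately show ?thesis by (simp add: closed_INT closed_Int)
  qed
  moreover have "bounded Q"
  proof -
    \<comment> \<open>\<open>\<mu>\<close> is the lower bound of \<open>\<alpha> \<bullet> p'\<close>. As no summand of \<open>\<alpha> \<bullet> (p - p')\<close> is negative, each is
      at most \<open>\<alpha> \<bullet> p - \<mu>\<close>, which bounds \<open>p'\<close> from below by \<open>L\<close>.\<close>
    define \<mu> where "\<mu> = y \<bullet> (b - b0) + \<alpha> \<bullet> p0"
    define L where "L i = p $ i - (\<alpha> \<bullet> p - \<mu>) / \<alpha> $ i" for i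
    have "Q \<subseteq> {(\<chi> i. L i) .. p}"
    proof
      fix p' assume "p' \<in> Q"
      then have p': "(b, p') \<in> ?G" "\<And>i. p' $ i \<le> p $ i" by (auto simp: Q_def)
      have \<mu>: "\<mu> \<le> \<alpha> \<bullet> p'" using y[OF p'(1)] by (simp add: \<mu>_def inner_diff_right)
      have "L i \<le> p' $ i" for i
      proof -
        have "\<alpha> $ i * (p $ i - p' $ i) \<le> (\<Sum>j\<in>UNIV. \<alpha> $ j * (p $ j - p' $ j))"
          using \<alpha> p'(2) by (intro member_le_sum) (auto simp: less_imp_le)
        also have "\<dots> = \<alpha> \<bullet> p - \<alpha> \<bullet> p'" by (simp add: inner_vec_def right_diff_distrib sum_subtractf)
        finally have "\<alpha> $ i * (p $ i - p' $ i) \<le> \<alpha> \<bullet> p - \<mu>" using \<mu> by simp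
        then show ?thesis using \<alpha>[of i] by (simp add: L_def field_simps)
      qed
      then show "p' \<in> {(\<chi> i. L i) .. p}" using p'(2) by (simp add: less_eq_vec_def)
    qed
    then show ?thesis using bounded_subset bounded_closed_interval by (metis interval_cbox_cart bounded_cbox)
  qed
  moreover have "p \<in> Q" using bp by (simp add: Q_def)
  ultimately obtain p' where p': "p' \<in> Q" and min: "\<And>z. z \<in> Q \<Longrightarrow> \<alpha> \<bullet> p' \<le> \<alpha> \<bullet> z"
    using continuous_attains_inf[of Q "\<lambda>z. \<alpha> \<bullet> z"] continuous_on_inner[OF continuous_on_const continuous_on_id]
    by (metis compact_eq_bounded_closed empty_iff)
  have strict: "z = p'" if zG: "(b, z) \<in> ?G" and le: "\<And>i. z $ i \<le> p' $ i" for z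
  proof (rule ccontr)
    assume "z \<noteq> p'"
    then obtain i where "z $ i < p' $ i" using le by (metis order_le_less vec_eq_iff)
    then have "\<alpha> \<bullet> z < \<alpha> \<bullet> p'"
      unfolding inner_vec_def using \<alpha> le
      by (intro sum_strict_mono_ex1) (auto simp: less_imp_le intro!: exI[of _ i])
    moreover have "z \<in> Q" using zG le p' unfolding Q_def by (auto intro: order_trans)
    ultimately show False using min[of z] by simp
  qed
  obtain x where x: "x \<in> feasible_set a b" "\<And>i. c i \<bullet> x \<le> p' $ i"
    using p' by (auto simp: Q_def objective_epigraph_def)
  have val: "(\<chi> i. c i \<bullet> z) = p'" if "z \<in> feasible_set a b" "\<And>i. c i \<bullet> z \<le> p' $ i" for z
    using that by (intro strict) (auto simp: objective_epigraph_def)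
  have cx: "c i \<bullet> x = p' $ i" for i using val[OF x] by (metis vec_lambda_beta)
  have "x \<in> efficient_set a c b"
    unfolding efficient_set_def
  proof (intro CollectI conjI notI x(1))
    assume "\<exists>z\<in>feasible_set a b. (\<forall>i. c i \<bullet> z \<le> c i \<bullet> x) \<and> (\<exists>i0. c i0 \<bullet> z < c i0 \<bullet> x)"
    then obtain z i where z: "z \<in> feasible_set a b" "\<And>i. c i \<bullet> z \<le> c i \<bullet> x" "c i \<bullet> z < c i \<bullet> x"
      by blast
    have "(\<chi> i. c i \<bullet> z) = p'" using z cx by (intro val) auto
    then show False using z(3) cx[of i] by (metis less_irrefl vec_lambda_beta)
  qed
  then have "p' \<in> pareto_front a c b" unfolding pareto_front_def using val[OF x] by blast
  then show ?thesis using that p' unfolding Q_def by blast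
qed

lemma epi_mapI: "p \<in> M b \<Longrightarrow> r \<in> nonneg_orthant \<Longrightarrow> p + r \<in> epi_map M b"
  unfolding epi_map_def by blast

text \<open>One attained Pareto point suffices to exclude unbounded behaviour for every parameter: the
  strictly positive normal found there works for all feasible sets at once.\<close>

lemma gph_epi_map_pareto_front:
  fixes a :: "'m::finite \<Rightarrow> real ^ 'n" and c :: "'q::finite \<Rightarrow> real ^ 'n"
  assumes "p0 \<in> pareto_front a c b0"
  shows "gph (epi_map (pareto_front a c)) = objective_epigraph a c"
proof safe
  fix b p assume "(b, p) \<in> gph (epi_map (pareto_front a c))"
  then show "(b, p) \<in> objective_epigraph a c"
    by (auto simp: gph_def epi_map_def
        intro: objective_epigraph_upward pareto_front_subset_objective_epigraph)
next
  fix b p assume "(b, p) \<in> objective_epigraph a c"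
  then obtain p' where "p' \<in> pareto_front a c b" "\<And>i. p' $ i \<le> p $ i"
    using domination_property[OF assms] by metis
  then have "p' + (p - p') \<in> epi_map (pareto_front a c) b"
    by (intro epi_mapI) (simp_all add: nonneg_orthant_def)
  then show "(b, p) \<in> gph (epi_map (pareto_front a c))" by (simp add: gph_def)
qed

section \<open>The subdifferential\<close>

lemma gph_subset_gph_epi_map: "gph M \<subseteq> gph (epi_map M)"
proof -
  have "p \<in> epi_map M b" if "p \<in> M b" for p b
    using epi_mapI[of p M b 0] that by (simp add: nonneg_orthant_def)
  then show ?thesis by (auto simp: gph_def)
qed

lemma inner_nonneg_orthant:
  "\<alpha> \<in> nonneg_orthant \<Longrightarrow> r \<in> nonneg_orthant \<Longrightarrow> 0 \<le> \<alpha> \<bullet> r"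
  by (simp add: nonneg_orthant_def inner_vec_def sum_nonneg)

text \<open>The sign condition in the definition of the subdifferential expresses that the orthant is
  its own dual cone.\<close>

lemma uminus_mem_normal_cone_nonneg_orthant:
  "- \<alpha> \<in> normal_cone nonneg_orthant 0 \<longleftrightarrow> \<alpha> \<in> nonneg_orthant"
proof
  assume *: "- \<alpha> \<in> normal_cone nonneg_orthant 0"
  have "0 \<le> \<alpha> $ i" for i
  proof -
    have "axis i 1 \<in> nonneg_orthant" by (simp add: nonneg_orthant_def axis_def)
    with * have "- \<alpha> \<bullet> (axis i 1 - 0) \<le> 0" unfolding normal_cone_def by blast
    then show ?thesis by (simp add: inner_axis)
  qed
  then show "\<alpha> \<in> nonneg_orthant" by (simp add: nonneg_orthant_def)
qed (auto simp: normal_cone_def inner_nonneg_orthant)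

lemma coderivative_epi_map_iff:
  assumes "\<alpha> \<in> nonneg_orthant"
  shows "y \<in> coderivative (epi_map M) b0 p0 \<alpha> \<longleftrightarrow>
    (\<forall>(b, p) \<in> gph M. y \<bullet> (b - b0) \<le> \<alpha> \<bullet> (p - p0))"
proof
  assume "y \<in> coderivative (epi_map M) b0 p0 \<alpha>"
  then show "\<forall>(b, p) \<in> gph M. y \<bullet> (b - b0) \<le> \<alpha> \<bullet> (p - p0)"
    using gph_subset_gph_epi_map unfolding coderivative_iff by blast
next
  assume *: "\<forall>(b, p) \<in> gph M. y \<bullet> (b - b0) \<le> \<alpha> \<bullet> (p - p0)"
  show "y \<in> coderivative (epi_map M) b0 p0 \<alpha>"
    unfolding coderivative_iff
  proof safe
    fix b p assume "(b, p) \<in> gph (epi_map M)"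
    then obtain z r where z: "(b, z) \<in> gph M" "r \<in> nonneg_orthant" "p = z + r"
      by (auto simp: gph_def epi_map_def)
    have "y \<bullet> (b - b0) \<le> \<alpha> \<bullet> (z - p0)" using * z(1) by blast
    also have "\<dots> \<le> \<alpha> \<bullet> (p - p0)"
      using inner_nonneg_orthant[OF assms z(2)] by (simp add: z(3) inner_diff_right inner_add_right)
    finally show "y \<bullet> (b - b0) \<le> \<alpha> \<bullet> (p - p0)" .
  qed
qed

lemma mem_subdifferential_iff:
  "y \<in> subdifferential N M b0 p0 \<longleftrightarrow>
    (\<exists>\<alpha>\<in>nonneg_orthant. dual_norm N \<alpha> = 1 \<and> y \<in> coderivative (epi_map M) b0 p0 \<alpha>)"
  unfolding subdifferential_def uminus_mem_normal_cone_nonneg_orthant by blast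

lemma scaleR_coderivative:
  assumes "y \<in> coderivative M b0 p0 \<alpha>" "0 \<le> r"
  shows "r *\<^sub>R y \<in> coderivative M b0 p0 (r *\<^sub>R \<alpha>)"
  using assms unfolding coderivative_iff by (auto intro!: mult_left_mono)

lemma add_coderivative:
  assumes "y \<in> coderivative M b0 p0 \<alpha>" "z \<in> coderivative M b0 p0 \<beta>"
  shows "y + z \<in> coderivative M b0 p0 (\<alpha> + \<beta>)"
  using assms unfolding coderivative_iff by (fastforce simp: inner_add_left intro: add_mono)

lemma scaleR_mem_subdifferential:
  assumes N: "is_norm N" and "\<alpha> \<in> nonneg_orthant" "\<alpha> \<noteq> 0"
    and "y \<in> coderivative (epi_map M) b0 p0 \<alpha>"
  shows "(1 / dual_norm N \<alpha>) *\<^sub>R y \<in> subdifferential N M b0 p0"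
proof -
  have pos: "0 < dual_norm N \<alpha>" by (rule dual_norm_pos) fact+
  have "(1 / dual_norm N \<alpha>) *\<^sub>R \<alpha> \<in> nonneg_orthant"
    using assms(2) pos by (simp add: nonneg_orthant_def)
  moreover have "dual_norm N ((1 / dual_norm N \<alpha>) *\<^sub>R \<alpha>) = 1"
    using dual_norm_scaleR[OF N, of "1 / dual_norm N \<alpha>" \<alpha>] pos by simp
  ultimately show ?thesis
    unfolding mem_subdifferential_iff
    using scaleR_coderivative[OF assms(4), of "1 / dual_norm N \<alpha>"] pos by auto
qed

lemma subdifferential_pareto_front_nonempty:
  fixes a :: "'m::finite \<Rightarrow> real ^ 'n" and c :: "'q::finite \<Rightarrow> real ^ 'n"
  assumes N: "is_norm N" and p0: "p0 \<in> pareto_front a c b0"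
  shows "subdifferential N (pareto_front a c) b0 p0 \<noteq> {}"
proof -
  obtain y \<alpha> where \<alpha>: "\<And>i. 0 < \<alpha> $ i"
    and y: "\<And>b p. (b, p) \<in> objective_epigraph a c \<Longrightarrow> y \<bullet> (b - b0) \<le> \<alpha> \<bullet> (p - p0)"
    using strictly_positive_normal_at_pareto_point[OF p0] by metis
  have "y \<in> coderivative (epi_map (pareto_front a c)) b0 p0 \<alpha>"
    unfolding coderivative_iff gph_epi_map_pareto_front[OF p0] using y by blast
  moreover have "\<alpha> \<in> nonneg_orthant" using \<alpha> by (simp add: nonneg_orthant_def less_imp_le)
  moreover have "\<alpha> \<noteq> 0" using \<alpha> by (metis less_irrefl zero_index)
  ultimately show ?thesis using scaleR_mem_subdifferential[OF N] by blast
qed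

text \<open>For \<open>\<alpha> = 0\<close> the ray \<open>z + r *\<^sub>R y\<close> through an element \<open>z\<close> of the subdifferential stays
  in it for all \<open>r \<ge> 0\<close>, so boundedness forces \<open>y = 0\<close>; this is where nonemptiness enters. For
  \<open>\<alpha> \<noteq> 0\<close> the normal is rescaled to \<open>dual_norm N \<alpha> = 1\<close>.\<close>

lemma coderivative_bound_of_subdifferential_bound:
  fixes a :: "'m::finite \<Rightarrow> real ^ 'n" and c :: "'q::finite \<Rightarrow> real ^ 'n"
  assumes N: "is_norm N" and p0: "p0 \<in> pareto_front a c b0"
    and bound: "\<And>y. y \<in> subdifferential N (pareto_front a c) b0 p0 \<Longrightarrow> l1_norm y \<le> l"
    and y: "y \<in> coderivative (epi_map (pareto_front a c)) b0 p0 \<alpha>"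
  shows "l1_norm y \<le> l * dual_norm N \<alpha>"
proof (cases "\<alpha> = 0")
  case True
  obtain z \<beta> where z: "z \<in> coderivative (epi_map (pareto_front a c)) b0 p0 \<beta>"
    "\<beta> \<in> nonneg_orthant" "dual_norm N \<beta> = 1"
    using subdifferential_pareto_front_nonempty[OF N p0]
    by (auto simp: set_eq_iff mem_subdifferential_iff)
  have ray: "r * l1_norm y \<le> l + l1_norm z" if "0 \<le> r" for r
  proof -
    have "z + r *\<^sub>R y \<in> coderivative (epi_map (pareto_front a c)) b0 p0 \<beta>"
      using add_coderivative[OF z(1) scaleR_coderivative[OF y that]] True by simp
    then have "l1_norm (z + r *\<^sub>R y) \<le> l"
      using z(2,3) by (intro bound) (auto simp: mem_subdifferential_iff)
    moreover have "l1_norm (r *\<^sub>R y) \<le> l1_norm (z + r *\<^sub>R y) + l1_norm (- z)"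
      using l1_norm_triangle[of "z + r *\<^sub>R y" "- z"] by simp
    moreover have "l1_norm (- z) = l1_norm z" by (simp add: l1_norm_def)
    ultimately show ?thesis using that by (simp add: l1_norm_scaleR)
  qed
  have "l1_norm y = 0"
  proof (rule ccontr)
    assume "l1_norm y \<noteq> 0"
    then have "0 < l1_norm y" using l1_norm_nonneg[of y] by simp
    moreover have "0 \<le> l + l1_norm z" using ray[of 0] by simp
    ultimately show False
      using ray[of "(l + l1_norm z + 1) / l1_norm y"] by simp
  qed
  moreover have "dual_norm N \<alpha> = 0"
    unfolding True
  proof (rule antisym)
    show "dual_norm N 0 \<le> 0" using N by (rule dual_norm_le) simp
    show "0 \<le> dual_norm N 0"
      using inner_le_dual_norm_unit[OF N, of 0 0] is_norm_eq_0_iff[OF N, of 0] by simp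
  qed
  ultimately show ?thesis by simp
next
  case False
  have "\<alpha> \<in> nonneg_orthant"
    using y pareto_front_subset_objective_epigraph[OF p0] normal_at_objective_epigraph_nonneg
    unfolding coderivative_iff gph_epi_map_pareto_front[OF p0] by blast
  then have "l1_norm ((1 / dual_norm N \<alpha>) *\<^sub>R y) \<le> l"
    using False y by (intro bound scaleR_mem_subdifferential[OF N])
  then show ?thesis
    using dual_norm_pos[OF N False] by (simp add: l1_norm_scaleR field_simps)
qed

section \<open>The Lipschitz modulus\<close>

text \<open>Nonnegativity of \<open>l\<close> is implied by the right-hand side because the subdifferential is
  nonempty; over the empty set the supremum would be \<open>-\<infinity>\<close>.\<close>

lemma lip_constant_epi_map_pareto_front_iff:
  fixes a :: "'m::finite \<Rightarrow> real ^ 'n" and c :: "'q::finite \<Rightarrow> real ^ 'n"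
  assumes N: "is_norm N" and p0: "p0 \<in> pareto_front a c b0"
  shows "lip_constant (\<lambda>b b'. infnorm (b - b')) (\<lambda>p p'. N (p - p')) (epi_map (pareto_front a c)) b0 p0 l
    \<longleftrightarrow> (SUP y \<in> subdifferential N (pareto_front a c) b0 p0. ereal (l1_norm y)) \<le> ereal l"
    (is "?lip \<longleftrightarrow> ?sup")
proof -
  let ?E = "epi_map (pareto_front a c)"
  have gph: "gph ?E = objective_epigraph a c" using p0 by (rule gph_epi_map_pareto_front)
  then have mem: "(b0, p0) \<in> gph ?E" using pareto_front_subset_objective_epigraph[OF p0] by simp
  have sup: "?sup \<longleftrightarrow> (\<forall>y\<in>subdifferential N (pareto_front a c) b0 p0. l1_norm y \<le> l)"
    by (simp add: SUP_le_iff)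
  show ?thesis
  proof
    assume ?lip
    then have "l1_norm y \<le> l * dual_norm N \<alpha>" if "y \<in> coderivative ?E b0 p0 \<alpha>" for y \<alpha>
      using coderivative_bound_of_lip_constant[OF N mem] that by blast
    then show ?sup unfolding sup
      by (metis mem_subdifferential_iff mult.right_neutral)
  next
    assume ?sup
    then have bound: "\<And>y. y \<in> subdifferential N (pareto_front a c) b0 p0 \<Longrightarrow> l1_norm y \<le> l"
      unfolding sup by blast
    then have "0 \<le> l"
      using subdifferential_pareto_front_nonempty[OF N p0] l1_norm_nonneg by (meson ex_in_conv order_trans)
    then show ?lip
      using coderivative_bound_of_subdifferential_bound[OF N p0 bound] mem
      by (intro lip_constant_of_coderivative_bound[OF N])
         (simp_all add: gph polyhedron_objective_epigraph)
  qed
qed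

theorem theorem7:
  fixes a :: "'m::finite \<Rightarrow> real ^ 'n"
    and c :: "'q::finite \<Rightarrow> real ^ 'n"
    and N :: "real ^ 'q \<Rightarrow> real"
    and b0 :: "real ^ 'm" and p0 :: "real ^ 'q"
  assumes "is_norm N"
    and "(b0, p0) \<in> gph (pareto_front a c)"
  shows "subdifferential N (pareto_front a c) b0 p0 =
           (\<Union>\<alpha> \<in> {\<alpha> \<in> nonneg_orthant. dual_norm N \<alpha> = 1}.
              {y. \<forall>(b, p) \<in> gph (pareto_front a c). y \<bullet> (b - b0) \<le> \<alpha> \<bullet> (p - p0)})
    \<and> lip_modulus (\<lambda>b b'. infnorm (b - b')) (\<lambda>p p'. N (p - p')) (epi_map (pareto_front a c)) b0 p0 =
           (SUP y \<in> subdifferential N (pareto_front a c) b0 p0. ereal (l1_norm y))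
    \<and> (lipschitz_like (\<lambda>b b'. infnorm (b - b')) (\<lambda>p p'. N (p - p')) (epi_map (pareto_front a c)) b0 p0 \<longleftrightarrow>
           (SUP y \<in> (\<Union>\<alpha> \<in> {\<alpha> \<in> nonneg_orthant. dual_norm N \<alpha> = 1}.
              {y. \<forall>(b, p) \<in> gph (pareto_front a c). y \<bullet> (b - b0) \<le> \<alpha> \<bullet> (p - p0)}). ereal (l1_norm y)) < \<infinity>)"
proof -
  let ?P = "pareto_front a c"
  let ?D = "subdifferential N ?P b0 p0"
  let ?lip = "lip_constant (\<lambda>b b'. infnorm (b - b')) (\<lambda>p p'. N (p - p')) (epi_map ?P) b0 p0"
  let ?L = "SUP y \<in> ?D. ereal (l1_norm y)"
  have p0: "p0 \<in> ?P b0" using assms(2) by (simp add: gph_def)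
  have lip: "?lip l \<longleftrightarrow> ?L \<le> ereal l" for l
    using assms(1) p0 by (rule lip_constant_epi_map_pareto_front_iff)
  have sub: "?D = (\<Union>\<alpha> \<in> {\<alpha> \<in> nonneg_orthant. dual_norm N \<alpha> = 1}.
              {y. \<forall>(b, p) \<in> gph ?P. y \<bullet> (b - b0) \<le> \<alpha> \<bullet> (p - p0)})"
    by (rule set_eqI) (auto simp: mem_subdifferential_iff coderivative_epi_map_iff)
  have "lip_modulus (\<lambda>b b'. infnorm (b - b')) (\<lambda>p p'. N (p - p')) (epi_map ?P) b0 p0 = ?L"
    unfolding lip_modulus_def lip
    by (rule antisym) (auto intro: INF_greatest ereal_le_real INF_lower)
  moreover have "lipschitz_like (\<lambda>b b'. infnorm (b - b')) (\<lambda>p p'. N (p - p')) (epi_map ?P) b0 p0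
      \<longleftrightarrow> ?L < \<infinity>"
  proof -
    have "(b0, p0) \<in> gph (epi_map ?P)" using assms(2) gph_subset_gph_epi_map by blast
    moreover have "(\<exists>l. ?L \<le> ereal l) \<longleftrightarrow> ?L < \<infinity>"
      by (cases ?L) auto
    ultimately show ?thesis unfolding lipschitz_like_def lip by blast
  qed
  ultimately show ?thesis unfolding sub[symmetric] using sub by blast
qed

end
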